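(* If $\mathcal{A}$ is an adequate family of finite subsets of $\mathbb{N}$, then $h_{\mathcal{A},1}$ does not have delta-points.
   Context: All Banach spaces are real. $B_X$, $S_X$, $X^*$ denote the closed unit ball, unit sphere and topological dual of a Banach space $X$. Adequate family: a family $\mathcal{A}$ of subsets of $\mathbb{N}=\{1,2,\dots\}$ is adequate if (1) it contains the empty set and all singletons $\{i\}$, $i\in\mathbb{N}$; (2) it is hereditary: $A\in\mathcal{A}$ and $B\subseteq A$ imply $B\in\mathcal{A}$; (3) it is compact for pointwise convergence, i.e. given $A\subset\mathbb{N}$, if every finite subset of $A$ is in $\mathcal{A}$, then $A\in\mathcal{A}$. An adequate family of finite subsets is one all of whose members are finite. The space $h_{\mathcal{A},1}$: the completion of the space $c_{00}$ of finitely supported sequences, with standard basis $(e_i)_{i\in\mathbb{N}}$, in the norm $\left\|\sum_{i=1}^n a_i e_i\right\| = \sup_{A\in\mathcal{A}}\sum_{i\in A}|a_i|$ (with $a_i=0$ for $i>n$). Slices: for $x^*\in S_{X^*}$ and $\delta>0$, $S(x^*,\delta)=\{x\in B_X : x^*(x)>1-\delta\}$. Delta-point: $x\in S_X$ is a delta-point of $X$ if for every slice $S(x^*,\delta)$ of $B_X$ with $x\in S(x^*,\delta)$ and every $\varepsilon>0$ there exists $y\in S(x^*,\delta)$ with $\|x-y\|\ge 2-\varepsilon$. *)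

theory Defs
  imports "HOL-Analysis.Analysis" "HOL-Library.Function_Algebras"
begin

section \<open>Sequences as a real vector space\<close>

instantiation "fun" :: (type, real_vector) real_vector
begin

definition scaleR_fun_def: "c *\<^sub>R f = (\<lambda>x. c *\<^sub>R f x)"

instance
  by standard (simp_all add: scaleR_fun_def fun_eq_iff scaleR_add_right scaleR_add_left)

end

section \<open>Delta-points of a normed space given by a carrier and a norm\<close>

text \<open>
  The space \<open>h\<^bsub>\<A>,1\<^esub>\<close> depends on a term, so it cannot be a type of class
  \<^class>\<open>banach\<close>.  A normed space is therefore given by a linear subspace \<open>V\<close> of an
  ambient real vector space and a norm \<open>N\<close> on \<open>V\<close>; the values of \<open>N\<close>, and of functionals on
  \<open>V\<close>, outside \<open>V\<close> are irrelevant.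
\<close>

definition unit_ball :: "'v::real_vector set \<Rightarrow> ('v \<Rightarrow> real) \<Rightarrow> 'v set" where
  "unit_ball V N = {x \<in> V. N x \<le> 1}"

definition unit_sphere :: "'v::real_vector set \<Rightarrow> ('v \<Rightarrow> real) \<Rightarrow> 'v set" where
  "unit_sphere V N = {x \<in> V. N x = 1}"

definition dual_space :: "'v::real_vector set \<Rightarrow> ('v \<Rightarrow> real) \<Rightarrow> ('v \<Rightarrow> real) set" where
  "dual_space V N = {f. (\<forall>x\<in>V. \<forall>y\<in>V. f (x + y) = f x + f y) \<and>
                        (\<forall>c. \<forall>x\<in>V. f (c *\<^sub>R x) = c * f x) \<and>
                        (\<exists>K. \<forall>x\<in>V. \<bar>f x\<bar> \<le> K * N x)}"

definition dual_norm :: "'v::real_vector set \<Rightarrow> ('v \<Rightarrow> real) \<Rightarrow> ('v \<Rightarrow> real) \<Rightarrow> real" where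
  "dual_norm V N f = (SUP x\<in>unit_ball V N. \<bar>f x\<bar>)"

definition dual_sphere :: "'v::real_vector set \<Rightarrow> ('v \<Rightarrow> real) \<Rightarrow> ('v \<Rightarrow> real) set" where
  "dual_sphere V N = {f \<in> dual_space V N. dual_norm V N f = 1}"

definition slice ::
  "'v::real_vector set \<Rightarrow> ('v \<Rightarrow> real) \<Rightarrow> ('v \<Rightarrow> real) \<Rightarrow> real \<Rightarrow> 'v set" where
  "slice V N f \<delta> = {x \<in> unit_ball V N. f x > 1 - \<delta>}"

definition delta_point :: "'v::real_vector set \<Rightarrow> ('v \<Rightarrow> real) \<Rightarrow> 'v \<Rightarrow> bool" where
  "delta_point V N x \<longleftrightarrow> x \<in> unit_sphere V N \<and>
     (\<forall>f\<in>dual_sphere V N. \<forall>\<delta>>0. x \<in> slice V N f \<delta> \<longrightarrow>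
        (\<forall>\<epsilon>>0. \<exists>y\<in>slice V N f \<delta>. N (x - y) \<ge> 2 - \<epsilon>))"

section \<open>Adequate families and the space \<open>h\<^bsub>\<A>,1\<^esub>\<close>\<close>

text \<open>
  The index set \<open>{1, 2, \<dots>}\<close> is replaced by the type \<^typ>\<open>nat\<close>, i.e. indices are shifted to
  start at 0.
\<close>

definition adequate :: "nat set set \<Rightarrow> bool" where
  "adequate \<A> \<longleftrightarrow> {} \<in> \<A> \<and> (\<forall>i. {i} \<in> \<A>) \<and>
     (\<forall>A\<in>\<A>. \<forall>B. B \<subseteq> A \<longrightarrow> B \<in> \<A>) \<and>
     (\<forall>A. (\<forall>F. finite F \<and> F \<subseteq> A \<longrightarrow> F \<in> \<A>) \<longrightarrow> A \<in> \<A>)"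

definition c00 :: "(nat \<Rightarrow> real) set" where
  "c00 = {x. finite {i. x i \<noteq> 0}}"

text \<open>
  The norm is first defined on all sequences, with values in \<^typ>\<open>ennreal\<close>, so that no
  convergence or boundedness side conditions arise.
\<close>

definition h1_enorm :: "nat set set \<Rightarrow> (nat \<Rightarrow> real) \<Rightarrow> ennreal" where
  "h1_enorm \<A> x = (SUP A\<in>\<A>. \<Sum>i. ennreal (if i \<in> A then \<bar>x i\<bar> else 0))"

definition h1_norm :: "nat set set \<Rightarrow> (nat \<Rightarrow> real) \<Rightarrow> real" where
  "h1_norm \<A> x = enn2real (h1_enorm \<A> x)"

text \<open>
  The completion of \<^const>\<open>c00\<close> is realised as its closure in the space of all sequences of
  finite norm.  The lemmas below show that this is indeed a completion: the norm is the given
  one on \<^const>\<open>c00\<close> (\<open>h1_norm_c00\<close>), \<^const>\<open>c00\<close> is dense (\<open>c00_dense\<close>), and the space is a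
  normed space (\<open>subspace_h1_space\<close>, \<open>h1_norm_eq_0\<close>, \<open>h1_norm_scaleR\<close>, \<open>h1_norm_triangle\<close>)
  which is complete (\<open>h1_space_complete\<close>).
\<close>

definition h1_space :: "nat set set \<Rightarrow> (nat \<Rightarrow> real) set" where
  "h1_space \<A> = {x. \<forall>\<epsilon>>0. \<exists>y\<in>c00. h1_enorm \<A> (x - y) < ennreal \<epsilon>}"

lemma adequate_hereditary: "adequate \<A> \<Longrightarrow> A \<in> \<A> \<Longrightarrow> B \<subseteq> A \<Longrightarrow> B \<in> \<A>"
  unfolding adequate_def by (elim conjE) (drule (1) bspec, drule spec, drule (1) mp)

lemma adequate_singleton: "adequate \<A> \<Longrightarrow> {i} \<in> \<A>"
  by (simp add: adequate_def)

lemma adequate_empty: "adequate \<A> \<Longrightarrow> {} \<in> \<A>"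
  by (simp add: adequate_def)

lemma h1_enorm_le_iff:
  assumes "adequate \<A>" "c \<ge> 0"
  shows "h1_enorm \<A> x \<le> ennreal c \<longleftrightarrow> (\<forall>B\<in>\<A>. finite B \<longrightarrow> (\<Sum>i\<in>B. \<bar>x i\<bar>) \<le> c)"
proof
  assume L: "h1_enorm \<A> x \<le> ennreal c"
  show "\<forall>B\<in>\<A>. finite B \<longrightarrow> (\<Sum>i\<in>B. \<bar>x i\<bar>) \<le> c"
  proof (intro ballI impI)
    fix B assume B: "B \<in> \<A>" "finite B"
    have "ennreal (\<Sum>i\<in>B. \<bar>x i\<bar>) = (\<Sum>i\<in>B. ennreal (if i \<in> B then \<bar>x i\<bar> else 0))"
      by (simp add: sum_ennreal)
    also have "\<dots> = (\<Sum>i. ennreal (if i \<in> B then \<bar>x i\<bar> else 0))"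
      by (rule suminf_finite[symmetric]) (use B in auto)
    also have "\<dots> \<le> h1_enorm \<A> x"
      unfolding h1_enorm_def by (rule SUP_upper) (use B in auto)
    also note L
    finally show "(\<Sum>i\<in>B. \<bar>x i\<bar>) \<le> c"
      using assms(2) by simp
  qed
next
  assume R: "\<forall>B\<in>\<A>. finite B \<longrightarrow> (\<Sum>i\<in>B. \<bar>x i\<bar>) \<le> c"
  show "h1_enorm \<A> x \<le> ennreal c"
    unfolding h1_enorm_def
  proof (rule SUP_least)
    fix A assume A: "A \<in> \<A>"
    show "(\<Sum>i. ennreal (if i \<in> A then \<bar>x i\<bar> else 0)) \<le> ennreal c"
    proof (rule suminf_le_const)
      fix n
      have "(\<Sum>i<n. ennreal (if i \<in> A then \<bar>x i\<bar> else 0)) =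
            ennreal (\<Sum>i<n. if i \<in> A then \<bar>x i\<bar> else 0)"
        by (rule sum_ennreal) auto
      also have "(\<Sum>i<n. if i \<in> A then \<bar>x i\<bar> else 0) = (\<Sum>i\<in>{..<n} \<inter> A. \<bar>x i\<bar>)"
        by (simp add: sum.inter_restrict)
      also have "ennreal \<dots> \<le> ennreal c"
        using R adequate_hereditary[OF assms(1) A, of "{..<n} \<inter> A"]
        by (intro ennreal_leI) auto
      finally show "(\<Sum>i<n. ennreal (if i \<in> A then \<bar>x i\<bar> else 0)) \<le> ennreal c" .
    qed auto
  qed
qed

lemma h1_enorm_c00_finite:
  assumes "adequate \<A>" "x \<in> c00"
  shows "h1_enorm \<A> x < top"
proof -
  have fin: "finite {i. x i \<noteq> 0}" using assms(2) by (simp add: c00_def)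
  have "h1_enorm \<A> x \<le> ennreal (\<Sum>i | x i \<noteq> 0. \<bar>x i\<bar>)"
  proof (subst h1_enorm_le_iff[OF assms(1)], simp add: sum_nonneg, intro ballI impI)
    fix B assume "B \<in> \<A>" "finite B"
    have "(\<Sum>i\<in>B. \<bar>x i\<bar>) = (\<Sum>i\<in>B \<inter> {i. x i \<noteq> 0}. \<bar>x i\<bar>)"
      by (rule sum.mono_neutral_right) (use \<open>finite B\<close> in auto)
    also have "\<dots> \<le> (\<Sum>i | x i \<noteq> 0. \<bar>x i\<bar>)"
      by (rule sum_mono2) (use fin in auto)
    finally show "(\<Sum>i\<in>B. \<bar>x i\<bar>) \<le> (\<Sum>i | x i \<noteq> 0. \<bar>x i\<bar>)" .
  qed
  then show ?thesis
    using ennreal_less_top le_less_trans by blast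
qed

lemma h1_enorm_add_le:
  assumes "adequate \<A>" "a \<ge> 0" "b \<ge> 0"
    and "h1_enorm \<A> x \<le> ennreal a" "h1_enorm \<A> y \<le> ennreal b"
  shows "h1_enorm \<A> (x + y) \<le> ennreal (a + b)"
proof -
  have "(\<Sum>i\<in>B. \<bar>(x + y) i\<bar>) \<le> a + b" if B: "B \<in> \<A>" "finite B" for B
  proof -
    have "(\<Sum>i\<in>B. \<bar>(x + y) i\<bar>) \<le> (\<Sum>i\<in>B. \<bar>x i\<bar>) + (\<Sum>i\<in>B. \<bar>y i\<bar>)"
      unfolding sum.distrib[symmetric] by (rule sum_mono) (simp add: abs_triangle_ineq)
    moreover have "(\<Sum>i\<in>B. \<bar>x i\<bar>) \<le> a"
      using assms B by (simp add: h1_enorm_le_iff)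
    moreover have "(\<Sum>i\<in>B. \<bar>y i\<bar>) \<le> b"
      using assms B by (simp add: h1_enorm_le_iff)
    ultimately show ?thesis by linarith
  qed
  then show ?thesis
    using assms by (simp add: h1_enorm_le_iff del: ennreal_plus)
qed

lemma h1_enorm_eq_h1_norm: "h1_enorm \<A> x < top \<Longrightarrow> h1_enorm \<A> x = ennreal (h1_norm \<A> x)"
  by (simp add: h1_norm_def)

lemma h1_norm_nonneg: "h1_norm \<A> x \<ge> 0"
  by (simp add: h1_norm_def)

lemma h1_enorm_scaleR_le:
  assumes "adequate \<A>" "a \<ge> 0" "h1_enorm \<A> x \<le> ennreal a"
  shows "h1_enorm \<A> (c *\<^sub>R x) \<le> ennreal (\<bar>c\<bar> * a)"
proof -
  have "(\<Sum>i\<in>B. \<bar>(c *\<^sub>R x) i\<bar>) \<le> \<bar>c\<bar> * a" if B: "B \<in> \<A>" "finite B" for B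
  proof -
    have "(\<Sum>i\<in>B. \<bar>(c *\<^sub>R x) i\<bar>) = \<bar>c\<bar> * (\<Sum>i\<in>B. \<bar>x i\<bar>)"
      by (simp add: scaleR_fun_def abs_mult sum_distrib_left)
    also have "\<dots> \<le> \<bar>c\<bar> * a"
      using assms B by (intro mult_left_mono) (simp_all add: h1_enorm_le_iff)
    finally show ?thesis .
  qed
  then show ?thesis
    using assms(1,2) by (simp only: h1_enorm_le_iff mult_nonneg_nonneg abs_ge_zero) blast
qed

lemma h1_enorm_minus_commute: "h1_enorm \<A> (x - y) = h1_enorm \<A> (y - x)"
  by (simp add: h1_enorm_def fun_diff_def abs_minus_commute cong: if_cong)

lemma h1_spaceD:
  "x \<in> h1_space \<A> \<Longrightarrow> \<epsilon> > 0 \<Longrightarrow> \<exists>y\<in>c00. h1_enorm \<A> (x - y) < ennreal \<epsilon>"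
  by (simp add: h1_space_def)

lemma h1_enorm_finite:
  assumes "adequate \<A>" "x \<in> h1_space \<A>"
  shows "h1_enorm \<A> x < top"
proof -
  obtain y where y: "y \<in> c00" "h1_enorm \<A> (x - y) < ennreal 1"
    using h1_spaceD[OF assms(2), of 1] by auto
  have "h1_enorm \<A> (x - y + y) \<le> ennreal (1 + h1_norm \<A> y)"
    using y h1_enorm_c00_finite[OF assms(1) y(1)]
    by (intro h1_enorm_add_le assms(1)) (auto simp: h1_norm_nonneg simp flip: h1_enorm_eq_h1_norm)
  then show ?thesis
    by (simp add: le_less_trans[OF _ ennreal_less_top] del: ennreal_plus)
qed

lemma h1_norm_le_iff:
  assumes "adequate \<A>" "x \<in> h1_space \<A>" "c \<ge> 0"
  shows "h1_norm \<A> x \<le> c \<longleftrightarrow> (\<forall>B\<in>\<A>. finite B \<longrightarrow> (\<Sum>i\<in>B. \<bar>x i\<bar>) \<le> c)"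
  using assms h1_enorm_eq_h1_norm[OF h1_enorm_finite[OF assms(1,2)]]
  by (simp flip: h1_enorm_le_iff)

lemma h1_enorm_zero: "h1_enorm \<A> 0 = 0"
  unfolding h1_enorm_def zero_fun_def
  by (cases "\<A> = {}") (simp_all add: bot_ennreal cong: if_cong)

lemma c00_dense:
  shows "c00 \<subseteq> h1_space \<A>"
    and "x \<in> h1_space \<A> \<Longrightarrow> \<epsilon> > 0 \<Longrightarrow> \<exists>y\<in>c00. h1_norm \<A> (x - y) < \<epsilon>"
proof -
  show "c00 \<subseteq> h1_space \<A>"
    unfolding h1_space_def by (auto intro!: bexI simp: h1_enorm_zero)
  assume "x \<in> h1_space \<A>" "\<epsilon> > 0"
  then obtain y where y: "y \<in> c00" "h1_enorm \<A> (x - y) < ennreal \<epsilon>"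
    unfolding h1_space_def by blast
  then have "h1_norm \<A> (x - y) < \<epsilon>"
    unfolding h1_norm_def using \<open>\<epsilon> > 0\<close> by (metis enn2real_less_iff ennreal_less_top order_less_trans)
  with y show "\<exists>y\<in>c00. h1_norm \<A> (x - y) < \<epsilon>" by blast
qed

lemma h1_norm_c00:
  assumes "adequate \<A>" "x \<in> c00"
  shows "h1_norm \<A> x = (SUP A\<in>\<A>. \<Sum>i | i \<in> A \<and> x i \<noteq> 0. \<bar>x i\<bar>)"
proof -
  have fin: "finite {i. i \<in> A \<and> x i \<noteq> 0}" for A
    using assms(2) by (auto simp: c00_def)
  have V: "x \<in> h1_space \<A>" using assms(2) c00_dense(1) by blast
  have ne: "\<A> \<noteq> {}" using adequate_empty[OF assms(1)] by blast
  have up: "(\<Sum>i | i \<in> A \<and> x i \<noteq> 0. \<bar>x i\<bar>) \<le> h1_norm \<A> x" if "A \<in> \<A>" for A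
    using h1_norm_le_iff[OF assms(1) V h1_norm_nonneg, of \<A> x] fin
      adequate_hereditary[OF assms(1) that, of "{i. i \<in> A \<and> x i \<noteq> 0}"] by auto
  have bdd: "bdd_above ((\<lambda>A. \<Sum>i | i \<in> A \<and> x i \<noteq> 0. \<bar>x i\<bar>) ` \<A>)"
    using up by (auto simp: bdd_above_def)
  have nn: "0 \<le> (SUP A\<in>\<A>. \<Sum>i | i \<in> A \<and> x i \<noteq> 0. \<bar>x i\<bar>)"
    using cSUP_upper[OF adequate_empty[OF assms(1)] bdd] by simp
  have le: "(\<Sum>i\<in>B. \<bar>x i\<bar>) \<le> (SUP A\<in>\<A>. \<Sum>i | i \<in> A \<and> x i \<noteq> 0. \<bar>x i\<bar>)"
    if "B \<in> \<A>" "finite B" for B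
  proof -
    have "(\<Sum>i\<in>B. \<bar>x i\<bar>) = (\<Sum>i | i \<in> B \<and> x i \<noteq> 0. \<bar>x i\<bar>)"
      by (rule sum.mono_neutral_right) (use that in auto)
    then show ?thesis using cSUP_upper[OF that(1) bdd] by simp
  qed
  show ?thesis
  proof (rule antisym)
    show "h1_norm \<A> x \<le> (SUP A\<in>\<A>. \<Sum>i | i \<in> A \<and> x i \<noteq> 0. \<bar>x i\<bar>)"
      using h1_norm_le_iff[OF assms(1) V nn] le by blast
    show "(SUP A\<in>\<A>. \<Sum>i | i \<in> A \<and> x i \<noteq> 0. \<bar>x i\<bar>) \<le> h1_norm \<A> x"
      by (rule cSUP_least[OF ne up])
  qed
qed

lemma subspace_c00: "subspace c00"
proof -
  have "finite {i. x i + y i \<noteq> 0}"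
    if "finite {i. x i \<noteq> 0}" "finite {i. y i \<noteq> 0}" for x y :: "nat \<Rightarrow> real"
    by (rule finite_subset[OF _ finite_UnI[OF that]]) auto
  then show ?thesis
    unfolding subspace_def c00_def by (auto simp: scaleR_fun_def)
qed

lemma subspace_h1_space:
  assumes "adequate \<A>"
  shows "subspace (h1_space \<A>)"
proof (rule subspaceI)
  show "0 \<in> h1_space \<A>"
    using c00_dense(1) subspace_0[OF subspace_c00] by blast
next
  fix x y assume xy: "x \<in> h1_space \<A>" "y \<in> h1_space \<A>"
  show "x + y \<in> h1_space \<A>"
    unfolding h1_space_def
  proof (clarify)
    fix \<epsilon> :: real assume \<epsilon>: "\<epsilon> > 0"
    then obtain u v where uv: "u \<in> c00" "v \<in> c00"
        "h1_enorm \<A> (x - u) < ennreal (\<epsilon>/3)" "h1_enorm \<A> (y - v) < ennreal (\<epsilon>/3)"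
      using h1_spaceD[OF xy(1), of "\<epsilon>/3"] h1_spaceD[OF xy(2), of "\<epsilon>/3"] by auto
    then have "h1_enorm \<A> ((x - u) + (y - v)) \<le> ennreal (\<epsilon>/3 + \<epsilon>/3)"
      using \<epsilon> by (intro h1_enorm_add_le assms) auto
    also have "\<dots> < ennreal \<epsilon>" using \<epsilon> by (intro ennreal_lessI) auto
    finally have "h1_enorm \<A> ((x + y) - (u + v)) < ennreal \<epsilon>"
      by (simp add: algebra_simps)
    then show "\<exists>w\<in>c00. h1_enorm \<A> (x + y - w) < ennreal \<epsilon>"
      using subspace_add[OF subspace_c00 uv(1,2)] by blast
  qed
next
  fix c :: real and x assume x: "x \<in> h1_space \<A>"
  show "c *\<^sub>R x \<in> h1_space \<A>"
    unfolding h1_space_def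
  proof (clarify)
    fix \<epsilon> :: real assume \<epsilon>: "\<epsilon> > 0"
    define \<eta> where "\<eta> = \<epsilon> / (\<bar>c\<bar> + 1)"
    have \<eta>: "\<eta> > 0" using \<epsilon> by (simp add: \<eta>_def add_nonneg_pos)
    then obtain u where u: "u \<in> c00" "h1_enorm \<A> (x - u) < ennreal \<eta>"
      using x unfolding h1_space_def by blast
    have "h1_enorm \<A> (c *\<^sub>R (x - u)) \<le> ennreal (\<bar>c\<bar> * \<eta>)"
      using u \<eta> by (intro h1_enorm_scaleR_le assms) auto
    also have "\<dots> < ennreal \<epsilon>"
    proof (rule ennreal_lessI[OF \<epsilon>])
      have "\<bar>c\<bar> * \<eta> < (\<bar>c\<bar> + 1) * \<eta>" using \<eta> by (simp add: distrib_right)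
      also have "\<dots> = \<epsilon>" unfolding \<eta>_def by (simp add: add_nonneg_eq_0_iff)
      finally show "\<bar>c\<bar> * \<eta> < \<epsilon>" .
    qed
    finally have "h1_enorm \<A> (c *\<^sub>R x - c *\<^sub>R u) < ennreal \<epsilon>"
      by (simp add: scaleR_right_diff_distrib)
    then show "\<exists>w\<in>c00. h1_enorm \<A> (c *\<^sub>R x - w) < ennreal \<epsilon>"
      using subspace_scale[OF subspace_c00 u(1)] by blast
  qed
qed

lemma h1_norm_coord_le:
  assumes "adequate \<A>" "x \<in> h1_space \<A>"
  shows "\<bar>x i\<bar> \<le> h1_norm \<A> x"
  using h1_norm_le_iff[OF assms h1_norm_nonneg, of \<A> x] adequate_singleton[OF assms(1), of i]
  by force

lemma h1_norm_eq_0: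
  assumes "adequate \<A>" "x \<in> h1_space \<A>"
  shows "h1_norm \<A> x = 0 \<longleftrightarrow> x = 0"
proof
  assume "h1_norm \<A> x = 0"
  then show "x = 0"
    using h1_norm_coord_le[OF assms] by (auto simp: fun_eq_iff)
qed (simp add: h1_norm_def h1_enorm_zero)

lemma h1_norm_triangle:
  assumes "adequate \<A>" "x \<in> h1_space \<A>" "y \<in> h1_space \<A>"
  shows "h1_norm \<A> (x + y) \<le> h1_norm \<A> x + h1_norm \<A> y"
proof -
  have "h1_enorm \<A> (x + y) \<le> ennreal (h1_norm \<A> x + h1_norm \<A> y)"
    using assms h1_enorm_finite[OF assms(1)]
    by (intro h1_enorm_add_le assms) (auto simp: h1_norm_nonneg simp flip: h1_enorm_eq_h1_norm)
  then show ?thesis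
    unfolding h1_norm_def[of \<A> "x + y"]
    by (intro enn2real_leI) (auto simp: h1_norm_nonneg)
qed

lemma h1_norm_scaleR:
  assumes "adequate \<A>" "x \<in> h1_space \<A>"
  shows "h1_norm \<A> (c *\<^sub>R x) = \<bar>c\<bar> * h1_norm \<A> x"
proof -
  have le: "h1_norm \<A> (c *\<^sub>R x) \<le> \<bar>c\<bar> * h1_norm \<A> x" if "x \<in> h1_space \<A>" for c x
  proof -
    have "h1_enorm \<A> (c *\<^sub>R x) \<le> ennreal (\<bar>c\<bar> * h1_norm \<A> x)"
      using h1_enorm_finite[OF assms(1) that]
      by (intro h1_enorm_scaleR_le assms) (auto simp: h1_norm_nonneg simp flip: h1_enorm_eq_h1_norm)
    then show ?thesis
      unfolding h1_norm_def[of \<A> "c *\<^sub>R x"]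
      by (intro enn2real_leI) (auto simp: h1_norm_nonneg)
  qed
  show ?thesis
  proof (cases "c = 0")
    case True
    then show ?thesis by (simp add: h1_norm_def h1_enorm_zero)
  next
    case False
    have "h1_norm \<A> (inverse c *\<^sub>R (c *\<^sub>R x)) \<le> \<bar>inverse c\<bar> * h1_norm \<A> (c *\<^sub>R x)"
      using le subspace_scale[OF subspace_h1_space[OF assms(1)] assms(2)] by blast
    then have "\<bar>c\<bar> * h1_norm \<A> x \<le> h1_norm \<A> (c *\<^sub>R x)"
      using False by (simp add: field_simps)
    with le[OF assms(2), of c] show ?thesis by simp
  qed
qed

lemma h1_space_complete:
  assumes "adequate \<A>"
  shows "Metric_space (h1_space \<A>) (\<lambda>x y. h1_norm \<A> (x - y))"
    and "Metric_space.mcomplete (h1_space \<A>) (\<lambda>x y. h1_norm \<A> (x - y))"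
proof -
  note sub = subspace_h1_space[OF assms]
  show M: "Metric_space (h1_space \<A>) (\<lambda>x y. h1_norm \<A> (x - y))"
  proof
    show "h1_norm \<A> (x - y) = 0 \<longleftrightarrow> x = y" if "x \<in> h1_space \<A>" "y \<in> h1_space \<A>" for x y
      using h1_norm_eq_0[OF assms subspace_diff[OF sub that]] by simp
    show "h1_norm \<A> (x - z) \<le> h1_norm \<A> (x - y) + h1_norm \<A> (y - z)"
      if "x \<in> h1_space \<A>" "y \<in> h1_space \<A>" "z \<in> h1_space \<A>" for x y z
      using h1_norm_triangle[OF assms subspace_diff[OF sub that(1,2)] subspace_diff[OF sub that(2,3)]]
      by simp
  qed (simp_all add: h1_norm_nonneg h1_norm_def h1_enorm_minus_commute)
  interpret Metric_space "h1_space \<A>" "\<lambda>x y. h1_norm \<A> (x - y)" by (rule M)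
  show "mcomplete"
    unfolding mcomplete_def
  proof (intro allI impI)
    fix \<sigma> assume "MCauchy \<sigma>"
    then have R: "range \<sigma> \<subseteq> h1_space \<A>"
      and C': "\<forall>\<epsilon>>0. \<exists>N. \<forall>m n. N \<le> m \<longrightarrow> N \<le> n \<longrightarrow> h1_norm \<A> (\<sigma> m - \<sigma> n) < \<epsilon>"
      unfolding MCauchy_def by auto
    have V: "\<sigma> n \<in> h1_space \<A>" for n
      using R by auto
    have C: "\<exists>N. \<forall>m\<ge>N. \<forall>n\<ge>N. h1_norm \<A> (\<sigma> m - \<sigma> n) < \<epsilon>" if "\<epsilon> > 0" for \<epsilon>
      using C'[rule_format, OF that] by auto
    have "Cauchy (\<lambda>n. \<sigma> n i)" for i
    proof (rule metric_CauchyI)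
      fix e :: real assume "e > 0"
      then obtain N where N: "\<forall>m\<ge>N. \<forall>n\<ge>N. h1_norm \<A> (\<sigma> m - \<sigma> n) < e"
        using C by blast
      have "dist (\<sigma> m i) (\<sigma> n i) \<le> h1_norm \<A> (\<sigma> m - \<sigma> n)" for m n
        using h1_norm_coord_le[OF assms subspace_diff[OF sub V V], of m n i]
        by (simp add: dist_real_def)
      with N show "\<exists>M. \<forall>m\<ge>M. \<forall>n\<ge>M. dist (\<sigma> m i) (\<sigma> n i) < e"
        by (meson le_less_trans)
    qed
    then have "\<exists>l. (\<lambda>n. \<sigma> n i) \<longlonglongrightarrow> l" for i
      using Cauchy_convergent convergent_def by blast
    then obtain x where x: "\<And>i. (\<lambda>n. \<sigma> n i) \<longlonglongrightarrow> x i" by metis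
    have lim: "\<exists>N. \<forall>n\<ge>N. h1_enorm \<A> (x - \<sigma> n) \<le> ennreal \<epsilon>" if "\<epsilon> > 0" for \<epsilon>
    proof -
      obtain N where N: "\<forall>m\<ge>N. \<forall>n\<ge>N. h1_norm \<A> (\<sigma> m - \<sigma> n) < \<epsilon>"
        using C \<open>\<epsilon> > 0\<close> by blast
      have "(\<Sum>i\<in>B. \<bar>(x - \<sigma> n) i\<bar>) \<le> \<epsilon>" if "n \<ge> N" "B \<in> \<A>" "finite B" for n B
      proof (rule LIMSEQ_le_const2)
        show "(\<lambda>m. \<Sum>i\<in>B. \<bar>(\<sigma> m - \<sigma> n) i\<bar>) \<longlonglongrightarrow> (\<Sum>i\<in>B. \<bar>(x - \<sigma> n) i\<bar>)"
          unfolding fun_diff_def by (intro tendsto_intros x)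
        have "(\<Sum>i\<in>B. \<bar>(\<sigma> m - \<sigma> n) i\<bar>) \<le> \<epsilon>" if "m \<ge> N" for m
          using N h1_norm_le_iff[OF assms subspace_diff[OF sub V V], of \<epsilon> m n] \<open>\<epsilon> > 0\<close>
            \<open>n \<ge> N\<close> \<open>m \<ge> N\<close> \<open>B \<in> \<A>\<close> \<open>finite B\<close> by (meson less_imp_le)
        then show "\<exists>N. \<forall>m\<ge>N. (\<Sum>i\<in>B. \<bar>(\<sigma> m - \<sigma> n) i\<bar>) \<le> \<epsilon>" by blast
      qed
      then show ?thesis
        using assms \<open>\<epsilon> > 0\<close> by (auto simp: h1_enorm_le_iff)
    qed
    have xV: "x \<in> h1_space \<A>"
      unfolding h1_space_def
    proof clarify
      fix \<epsilon> :: real assume \<epsilon>: "\<epsilon> > 0"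
      then obtain n where n: "h1_enorm \<A> (x - \<sigma> n) \<le> ennreal (\<epsilon>/3)"
        using lim[of "\<epsilon>/3"] by auto
      obtain y where y: "y \<in> c00" "h1_enorm \<A> (\<sigma> n - y) < ennreal (\<epsilon>/3)"
        using h1_spaceD[OF V[of n], of "\<epsilon>/3"] \<epsilon> by auto
      have "h1_enorm \<A> ((x - \<sigma> n) + (\<sigma> n - y)) \<le> ennreal (\<epsilon>/3 + \<epsilon>/3)"
        using \<epsilon> n y by (intro h1_enorm_add_le assms) auto
      also have "\<dots> < ennreal \<epsilon>" using \<epsilon> by (intro ennreal_lessI) auto
      finally show "\<exists>y\<in>c00. h1_enorm \<A> (x - y) < ennreal \<epsilon>"
        using y(1) by auto
    qed
    have "\<exists>N. \<forall>n\<ge>N. \<sigma> n \<in> h1_space \<A> \<and> h1_norm \<A> (\<sigma> n - x) < \<epsilon>" if "\<epsilon> > 0" for \<epsilon>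
    proof -
      obtain N where N: "\<forall>n\<ge>N. h1_enorm \<A> (x - \<sigma> n) \<le> ennreal (\<epsilon>/2)"
        using lim[of "\<epsilon>/2"] \<open>\<epsilon> > 0\<close> by auto
      have "h1_norm \<A> (\<sigma> n - x) < \<epsilon>" if "n \<ge> N" for n
      proof -
        have "h1_norm \<A> (\<sigma> n - x) \<le> \<epsilon>/2"
          unfolding h1_norm_def using N that \<open>\<epsilon> > 0\<close>
          by (intro enn2real_leI) (auto simp: h1_enorm_minus_commute[of \<A> "\<sigma> n"])
        then show ?thesis using \<open>\<epsilon> > 0\<close> by simp
      qed
      then show ?thesis using V by blast
    qed
    then show "\<exists>x. limitin mtopology \<sigma> x sequentially"
      unfolding limit_metric_sequentially using xV by blast
  qed
qed

end

theory Submission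
  imports Defs
begin

text \<open>
  Let \<open>x\<close> have norm \<open>1\<close>.  Compactness of \<open>\<A>\<close> together with finiteness of its members shows that
  only finitely many \<open>A \<in> \<A>\<close> contained in the support of \<open>x\<close> have \<open>\<Sum>i\<in>A. \<bar>x i\<bar>\<close> close to \<open>1\<close>, and
  that these sums are then equal to \<open>1\<close>.  Let \<open>f\<close> be the average of the functionals
  \<open>y \<mapsto> \<Sum>i\<in>A. sgn (x i) * y i\<close> over these \<open>A\<close>.  If \<open>f y\<close> is close to \<open>1\<close>, then on each such \<open>A\<close>
  some \<open>y i\<close> has the sign of \<open>x i\<close> and is bounded away from \<open>0\<close>, so that cancellation
  keeps \<open>\<Sum>i\<in>B. \<bar>x i - y i\<bar>\<close> away from \<open>2\<close> for all \<open>B\<close> containing \<open>A\<close>; for the remaining \<open>B\<close>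
  the sum of \<open>\<bar>x i\<bar>\<close> is already away from \<open>1\<close>.
\<close>

section \<open>Tails of vectors and maximal sets\<close>

lemma h1_norm_sum_le:
  assumes "adequate \<A>" "x \<in> h1_space \<A>" "B \<in> \<A>" "finite B"
  shows "(\<Sum>i\<in>B. \<bar>x i\<bar>) \<le> h1_norm \<A> x"
  using h1_norm_le_iff[OF assms(1,2) h1_norm_nonneg] assms(3,4) by blast

text \<open>A finitely supported \<open>y\<close> close to \<open>x\<close> vanishes from some
  \<open>n\<close> on, so beyond \<open>n\<close> the sums for \<open>x\<close> are those for
  \<open>x - y\<close>.\<close>

lemma h1_space_tail_le:
  assumes "adequate \<A>" "x \<in> h1_space \<A>" "\<epsilon> > 0"
  shows "\<exists>n. \<forall>B\<in>\<A>. finite B \<and> (\<forall>i\<in>B. n \<le> i) \<longrightarrow> (\<Sum>i\<in>B. \<bar>x i\<bar>) \<le> \<epsilon>"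
proof -
  obtain y where y: "y \<in> c00" "h1_norm \<A> (x - y) < \<epsilon>"
    using c00_dense(2)[OF assms(2,3)] by blast
  have V: "x - y \<in> h1_space \<A>"
    using subspace_diff[OF subspace_h1_space[OF assms(1)] assms(2)] c00_dense(1) y(1) by blast
  obtain n where n: "\<forall>i. y i \<noteq> 0 \<longrightarrow> i < n"
    using y(1) unfolding c00_def finite_nat_set_iff_bounded by blast
  have "(\<Sum>i\<in>B. \<bar>x i\<bar>) \<le> \<epsilon>" if B: "B \<in> \<A>" "finite B" "\<forall>i\<in>B. n \<le> i" for B
  proof -
    have "y i = 0" if "i \<in> B" for i
      using n B(3) that leD by blast
    then have "(\<Sum>i\<in>B. \<bar>x i\<bar>) = (\<Sum>i\<in>B. \<bar>(x - y) i\<bar>)"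
      by simp
    also have "\<dots> \<le> \<epsilon>"
      using h1_norm_sum_le[OF assms(1) V B(1,2)] y(2) by simp
    finally show ?thesis .
  qed
  then show ?thesis by blast
qed

text \<open>Zorn applies to an arbitrary subfamily \<open>G\<close>: compactness puts the union of a
  chain in \<open>\<A>\<close>, so the union is finite and a single member of the chain already
  contains it.\<close>

lemma adequate_maximal:
  assumes "adequate \<A>" "\<forall>A\<in>\<A>. finite A" "G \<subseteq> \<A>" "G \<noteq> {}"
  shows "\<exists>F\<in>G. \<forall>X\<in>G. F \<subseteq> X \<longrightarrow> X = F"
proof (rule subset_Zorn_nonempty[OF assms(4)])
  fix C assume C: "C \<noteq> {}" "subset.chain G C"
  then have sub: "C \<subseteq> G" by (simp add: subset_chain_def)
  have le: "\<exists>X\<in>C. F \<subseteq> X" if "finite F" "F \<subseteq> \<Union>C" for F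
    using finite_subset_Union_chain[OF that C] by blast
  have "F \<in> \<A>" if "finite F" "F \<subseteq> \<Union>C" for F
    using le[OF that] sub assms(3) adequate_hereditary[OF assms(1)] by blast
  then have "\<Union>C \<in> \<A>"
    using assms(1) unfolding adequate_def by blast
  then have "finite (\<Union>C)" using assms(2) by blast
  then obtain X where "X \<in> C" "\<Union>C \<subseteq> X" using le by blast
  then have "\<Union>C = X" by blast
  with \<open>X \<in> C\<close> sub show "\<Union>C \<in> G" by blast
qed

section \<open>Norming sets of a vector\<close>

text \<open>The restriction to the support matters: indices where \<open>x\<close> vanishes can be
  added to a set without changing its sum.\<close>

lemma finite_nearly_norming:
  assumes "adequate \<A>" "\<forall>A\<in>\<A>. finite A" "x \<in> h1_space \<A>"
  shows "\<exists>\<gamma>>0. finite {A\<in>\<A>. A \<subseteq> {i. x i \<noteq> 0} \<and> h1_norm \<A> x - \<gamma> < (\<Sum>i\<in>A. \<bar>x i\<bar>)}"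
proof (rule ccontr)
  define M where "M \<gamma> = {A\<in>\<A>. A \<subseteq> {i. x i \<noteq> 0} \<and> h1_norm \<A> x - \<gamma> < (\<Sum>i\<in>A. \<bar>x i\<bar>)}" for \<gamma>
  have Mmono: "M \<gamma> \<subseteq> M \<delta>" if "\<gamma> \<le> \<delta>" for \<gamma> \<delta>
    using that by (auto simp: M_def)
  \<comment> \<open>A maximal member \<open>F\<close> of \<open>G\<close> acts as a cluster point of the sets \<open>M \<gamma>\<close> as \<open>\<gamma> \<rightarrow> 0\<close>: since no proper
    extension of \<open>F\<close> is in \<open>G\<close>, members of \<open>M \<gamma>\<close> exceed \<open>F\<close> only far out, so \<open>F\<close> itself attains
    the norm and no strictly larger subset of the support can belong to \<open>\<A>\<close>.\<close>
  define G where "G = {F. \<forall>\<gamma>>0. infinite {A \<in> M \<gamma>. F \<subseteq> A}}"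
  assume "\<not> ?thesis"
  then have "{} \<in> G" by (auto simp: G_def M_def)
  moreover have "G \<subseteq> \<A>"
  proof
    fix F assume "F \<in> G"
    then have "infinite {A \<in> M 1. F \<subseteq> A}" by (simp add: G_def)
    then obtain A where "A \<in> \<A>" "F \<subseteq> A"
      using not_finite_existsD unfolding M_def by blast
    then show "F \<in> \<A>" using adequate_hereditary[OF assms(1)] by blast
  qed
  ultimately obtain F where F: "F \<in> G" and max: "\<forall>X\<in>G. F \<subseteq> X \<longrightarrow> X = F"
    using adequate_maximal[OF assms(1,2), of G] by force
  have "h1_norm \<A> x \<le> (\<Sum>i\<in>F. \<bar>x i\<bar>)"
  proof (rule field_le_epsilon)
    fix \<epsilon> :: real assume \<epsilon>: "\<epsilon> > 0"
    then obtain n where n: "\<And>B. \<lbrakk>B \<in> \<A>; finite B; \<forall>i\<in>B. n \<le> i\<rbrakk> \<Longrightarrow> (\<Sum>i\<in>B. \<bar>x i\<bar>) \<le> \<epsilon>/2"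
      using h1_space_tail_le[OF assms(1,3), of "\<epsilon>/2"] by auto
    have "\<exists>\<gamma>>0. finite {A \<in> M \<gamma>. insert i F \<subseteq> A}" if "i \<notin> F" for i
    proof -
      have "insert i F \<notin> G" using max that by blast
      then show ?thesis by (auto simp: G_def)
    qed
    then obtain g where g: "\<And>i. i \<notin> F \<Longrightarrow> g i > 0 \<and> finite {A \<in> M (g i). insert i F \<subseteq> A}"
      by metis
    \<comment> \<open>For each \<open>i < n\<close> outside \<open>F\<close>,
      \<open>\<gamma> \<le> g i\<close> leaves only finitely many members of
      \<open>M \<gamma>\<close> that contain \<open>insert i F\<close>. Infinitely many contain
      \<open>F\<close>, so some \<open>A\<close> extends \<open>F\<close> only by indices from
      \<open>n\<close> on.\<close>
    define \<gamma> where "\<gamma> = Min (insert (\<epsilon>/2) (g ` ({..<n} - F)))"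
    have \<gamma>: "\<gamma> > 0" using \<epsilon> g by (auto simp: \<gamma>_def)
    have \<gamma>le: "\<gamma> \<le> \<epsilon>/2" "\<And>i. i \<in> {..<n} - F \<Longrightarrow> \<gamma> \<le> g i"
      unfolding \<gamma>_def by (rule Min_le, simp, blast)+
    have "finite (\<Union>i\<in>{..<n} - F. {A \<in> M (g i). insert i F \<subseteq> A})"
      using g by blast
    moreover have "infinite {A \<in> M \<gamma>. F \<subseteq> A}"
      using F \<gamma> by (simp add: G_def)
    ultimately obtain A where A: "A \<in> M \<gamma>" "F \<subseteq> A"
        "A \<notin> (\<Union>i\<in>{..<n} - F. {A \<in> M (g i). insert i F \<subseteq> A})"
      by (metis (no_types, lifting) finite_subset mem_Collect_eq subsetI)
    have An: "\<forall>i\<in>A - F. n \<le> i"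
    proof
      fix i assume i: "i \<in> A - F"
      show "n \<le> i"
      proof (rule ccontr)
        assume "\<not> n \<le> i"
        then have "i \<in> {..<n} - F" using i by auto
        then have "A \<in> M (g i)" using A(1) \<gamma>le(2) Mmono by blast
        then show False using A(2,3) i \<open>i \<in> {..<n} - F\<close> by blast
      qed
    qed
    have AA: "A \<in> \<A>" "h1_norm \<A> x - \<gamma> < (\<Sum>i\<in>A. \<bar>x i\<bar>)" using A(1) by (auto simp: M_def)
    have finA: "finite A" using assms(2) AA(1) by blast
    have "(\<Sum>i\<in>A. \<bar>x i\<bar>) = (\<Sum>i\<in>A - F. \<bar>x i\<bar>) + (\<Sum>i\<in>F. \<bar>x i\<bar>)"
      by (rule sum.subset_diff[OF A(2) finA])
    moreover have "(\<Sum>i\<in>A - F. \<bar>x i\<bar>) \<le> \<epsilon>/2"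
      using An finA adequate_hereditary[OF assms(1) AA(1), of "A - F"] by (intro n) auto
    ultimately show "h1_norm \<A> x \<le> (\<Sum>i\<in>F. \<bar>x i\<bar>) + \<epsilon>"
      using AA(2) \<gamma>le(1) by linarith
  qed
  \<comment> \<open>Indices in the support carry positive weight, so a proper extension of the
    norming set \<open>F\<close> would exceed the norm.\<close>
  then have "{A \<in> M 1. F \<subseteq> A} \<subseteq> {F}"
  proof (intro subsetI)
    fix A assume le: "h1_norm \<A> x \<le> (\<Sum>i\<in>F. \<bar>x i\<bar>)" and "A \<in> {A \<in> M 1. F \<subseteq> A}"
    then have A: "A \<in> \<A>" "A \<subseteq> {i. x i \<noteq> 0}" "F \<subseteq> A" by (auto simp: M_def)
    have finA: "finite A" using assms(2) A(1) by blast
    have "(\<Sum>i\<in>A. \<bar>x i\<bar>) = (\<Sum>i\<in>A - F. \<bar>x i\<bar>) + (\<Sum>i\<in>F. \<bar>x i\<bar>)"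
      by (rule sum.subset_diff[OF A(3) finA])
    then have "(\<Sum>i\<in>A - F. \<bar>x i\<bar>) \<le> 0"
      using le h1_norm_sum_le[OF assms(1,3) A(1) finA] by linarith
    then have "A - F = {}"
      using finA A(2) sum_pos[of "A - F" "\<lambda>i. \<bar>x i\<bar>"] by fastforce
    with A(3) show "A \<in> {F}" by blast
  qed
  moreover have "infinite {A \<in> M 1. F \<subseteq> A}" using F by (simp add: G_def)
  ultimately show False using finite_subset by blast
qed

text \<open>Among finitely many nearly norming sets, those that miss the norm have a least positive
  deficit. Any smaller deficit must be zero.\<close>

lemma finite_norming_gap:
  assumes "adequate \<A>" "\<forall>A\<in>\<A>. finite A" "x \<in> h1_space \<A>"
  defines "M \<equiv> {A\<in>\<A>. A \<subseteq> {i. x i \<noteq> 0} \<and> (\<Sum>i\<in>A. \<bar>x i\<bar>) = h1_norm \<A> x}"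
  shows "finite M \<and> (\<exists>\<gamma>>0. \<forall>B\<in>\<A>. h1_norm \<A> x - \<gamma> < (\<Sum>i\<in>B. \<bar>x i\<bar>) \<longrightarrow> (\<exists>A\<in>M. A \<subseteq> B))"
proof -
  obtain \<eta> where \<eta>: "\<eta> > 0"
    and fin: "finite {A\<in>\<A>. A \<subseteq> {i. x i \<noteq> 0} \<and> h1_norm \<A> x - \<eta> < (\<Sum>i\<in>A. \<bar>x i\<bar>)}"
    using finite_nearly_norming[OF assms(1-3)] by blast
  let ?K = "{A\<in>\<A>. A \<subseteq> {i. x i \<noteq> 0} \<and> h1_norm \<A> x - \<eta> < (\<Sum>i\<in>A. \<bar>x i\<bar>)}"
  define D where "D = (\<lambda>A. h1_norm \<A> x - (\<Sum>i\<in>A. \<bar>x i\<bar>)) ` (?K - M)"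
  have finM: "finite M" by (rule finite_subset[OF _ fin]) (use \<eta> in \<open>auto simp: M_def\<close>)
  have finD: "finite D" using fin by (simp add: D_def)
  have "h1_norm \<A> x - (\<Sum>i\<in>A. \<bar>x i\<bar>) > 0" if "A \<in> ?K - M" for A
    using that h1_norm_sum_le[OF assms(1,3), of A] assms(2) by (force simp: M_def)
  then have Dpos: "\<forall>d\<in>D. d > 0" by (auto simp: D_def)
  \<comment> \<open>Including \<open>\<eta>\<close> keeps the sets inside the finite family
    \<open>?K\<close> and covers the case of empty \<open>D\<close>.\<close>
  define \<gamma> where "\<gamma> = Min (insert \<eta> D)"
  have "\<gamma> > 0" using \<eta> finD Dpos by (auto simp: \<gamma>_def)
  moreover have "\<exists>A\<in>M. A \<subseteq> B" if B: "B \<in> \<A>" "h1_norm \<A> x - \<gamma> < (\<Sum>i\<in>B. \<bar>x i\<bar>)" for B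
  proof -
    let ?A = "B \<inter> {i. x i \<noteq> 0}"
    have "(\<Sum>i\<in>?A. \<bar>x i\<bar>) = (\<Sum>i\<in>B. \<bar>x i\<bar>)"
      using assms(2) B(1) by (intro sum.mono_neutral_left) auto
    then have less: "h1_norm \<A> x - (\<Sum>i\<in>?A. \<bar>x i\<bar>) < \<gamma>" using B(2) by linarith
    have "\<gamma> \<le> \<eta>" using finD by (simp add: \<gamma>_def)
    then have "?A \<in> ?K"
      using less adequate_hereditary[OF assms(1) B(1), of ?A] by auto
    moreover have "h1_norm \<A> x - (\<Sum>i\<in>?A. \<bar>x i\<bar>) \<notin> D"
      using less finD by (auto simp: \<gamma>_def)
    ultimately have "?A \<in> M" by (auto simp: D_def)
    then show ?thesis by blast
  qed
  ultimately show ?thesis using finM by blast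
qed

section \<open>Signs and averages\<close>

text \<open>For equal signs, \<open>\<bar>a - b\<bar>\<close> is
  \<open>\<bar>a\<bar> + \<bar>b\<bar>\<close> minus twice the smaller modulus.\<close>

lemma abs_diff_cancellation:
  fixes a b \<kappa> :: real
  assumes "\<kappa> \<ge> 0" "\<kappa> \<le> \<bar>a\<bar>" "\<kappa> \<le> sgn a * b"
  shows "\<bar>a - b\<bar> \<le> \<bar>a\<bar> + \<bar>b\<bar> - 2 * \<kappa>"
  using assms by (cases a "0::real" rule: linorder_cases) auto

lemma abs_sgn_sum_le:
  fixes x y :: "'a \<Rightarrow> real"
  shows "\<bar>\<Sum>i\<in>A. sgn (x i) * y i\<bar> \<le> (\<Sum>i\<in>A. \<bar>y i\<bar>)"
  by (rule order_trans[OF sum_abs sum_mono]) (simp add: abs_mult abs_sgn_eq)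

text \<open>No other term can make up for a small one, so the deficit of one term is at most that of
  the whole sum.\<close>

lemma finite_average_near_max:
  fixes g :: "'a \<Rightarrow> real" and \<delta> :: real
  assumes "finite M" "\<And>A. A \<in> M \<Longrightarrow> g A \<le> 1" "A \<in> M"
    and "1 - \<delta> < (\<Sum>A\<in>M. g A) / card M"
  shows "1 - card M * \<delta> < g A"
proof -
  have "card M > 0" using assms(1,3) card_gt_0_iff by blast
  then have "card M - card M * \<delta> < (\<Sum>A\<in>M. g A)"
    using assms(4) by (simp add: field_simps)
  also have "\<dots> = g A + (\<Sum>A\<in>M - {A}. g A)"
    by (rule sum.remove[OF assms(1,3)])
  also have "(\<Sum>A\<in>M - {A}. g A) \<le> real (card (M - {A}))"
    using sum_bounded_above[of "M - {A}" g 1] assms(2) by simp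
  also have "real (card (M - {A})) = card M - 1"
    using assms(1,3) \<open>card M > 0\<close> by (simp add: of_nat_diff)
  finally show ?thesis using \<open>card M > 0\<close> by linarith
qed

section \<open>The averaged functional and its slice\<close>

theorem proposition4p6:
  fixes \<A> :: "nat set set"
  assumes "adequate \<A>"
    and "\<forall>A\<in>\<A>. finite A"
  shows "\<not> (\<exists>x. delta_point (h1_space \<A>) (h1_norm \<A>) x)"
proof
  let ?V = "h1_space \<A>" and ?N = "h1_norm \<A>"
  assume "\<exists>x. delta_point ?V ?N x"
  then obtain x where dp: "delta_point ?V ?N x" by blast
  then have x: "x \<in> ?V" "?N x = 1" by (auto simp: delta_point_def unit_sphere_def)
  define M where "M = {A\<in>\<A>. A \<subseteq> {i. x i \<noteq> 0} \<and> (\<Sum>i\<in>A. \<bar>x i\<bar>) = 1}"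
  obtain \<gamma> where finM: "finite M" and \<gamma>: "\<gamma> > 0"
      and gap: "\<And>B. \<lbrakk>B \<in> \<A>; 1 - \<gamma> < (\<Sum>i\<in>B. \<bar>x i\<bar>)\<rbrakk> \<Longrightarrow> \<exists>A\<in>M. A \<subseteq> B"
    using finite_norming_gap[OF assms x(1)] unfolding x(2) M_def[symmetric] by blast
  have MA: "A \<in> \<A>" "finite A" "A \<subseteq> {i. x i \<noteq> 0}" "(\<Sum>i\<in>A. \<bar>x i\<bar>) = 1" if "A \<in> M" for A
    using that assms(2) by (auto simp: M_def)
  have "M \<noteq> {}"
  proof
    assume "M = {}"
    then have "(\<Sum>i\<in>B. \<bar>x i\<bar>) \<le> 1 - \<gamma>" if "B \<in> \<A>" for B
      using gap[OF that] by force
    \<comment> \<open>\<open>h1_norm_le_iff\<close> requires a nonnegative bound; the empty sum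
      supplies it.\<close>
    moreover from this[of "{}"] have "0 \<le> 1 - \<gamma>"
      using adequate_empty[OF assms(1)] by simp
    ultimately have "?N x \<le> 1 - \<gamma>"
      using h1_norm_le_iff[OF assms(1) x(1)] by blast
    with x(2) \<gamma> show False by simp
  qed
  then have cM: "card M > 0" using finM by (simp add: card_gt_0_iff)
  define g where "g A y = (\<Sum>i\<in>A. sgn (x i) * y i)" for A and y :: "nat \<Rightarrow> real"
  have g_le: "\<bar>g A y\<bar> \<le> ?N y" if "A \<in> M" "y \<in> ?V" for A y
    using abs_sgn_sum_le[of x y A] h1_norm_sum_le[OF assms(1) that(2) MA(1,2)[OF that(1)]]
    by (simp add: g_def)
  have g_x: "g A x = 1" if "A \<in> M" for A
    using MA(4)[OF that] by (simp add: g_def mult.commute[of "sgn _"] flip: abs_sgn)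
  define f where "f y = (\<Sum>A\<in>M. g A y) / card M" for y
  have f_le: "\<bar>f y\<bar> \<le> ?N y" if "y \<in> ?V" for y
  proof -
    have "\<bar>\<Sum>A\<in>M. g A y\<bar> \<le> (\<Sum>A\<in>M. \<bar>g A y\<bar>)" by (rule sum_abs)
    also have "\<dots> \<le> card M * ?N y"
      using sum_bounded_above[of M "\<lambda>A. \<bar>g A y\<bar>" "?N y"] g_le that by simp
    finally show ?thesis using cM by (simp add: f_def field_simps)
  qed
  have f_x: "f x = 1" using cM g_x by (simp add: f_def)
  have "f (y + z) = f y + f z" for y z
    by (simp add: f_def g_def distrib_left sum.distrib add_divide_distrib)
  moreover have "f (c *\<^sub>R y) = c * f y" for c y
    by (simp add: f_def g_def scaleR_fun_def sum_distrib_left mult.left_commute)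
  ultimately have "f \<in> dual_space ?V ?N"
    unfolding dual_space_def using f_le by (auto intro!: exI[of _ 1])
  moreover have "dual_norm ?V ?N f = 1"
    unfolding dual_norm_def
  proof (rule cSup_eq_maximum)
    show "1 \<in> (\<lambda>y. \<bar>f y\<bar>) ` unit_ball ?V ?N"
      using x f_x by (force simp: unit_ball_def)
    show "r \<le> 1" if "r \<in> (\<lambda>y. \<bar>f y\<bar>) ` unit_ball ?V ?N" for r
      using that f_le by (force simp: unit_ball_def)
  qed
  ultimately have fS: "f \<in> dual_sphere ?V ?N" by (simp add: dual_sphere_def)
  \<comment> \<open>Then \<open>card M * \<delta> = 1/2\<close>, so
    \<open>f y > 1 - \<delta>\<close> forces \<open>g A y > 1/2\<close> for every \<open>A\<close>
    in \<open>M\<close>.\<close>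
  define \<delta> where "\<delta> = 1 / (2 * real (card M))"
  have \<delta>: "\<delta> > 0" using cM by (simp add: \<delta>_def)
  have xS: "x \<in> slice ?V ?N f \<delta>"
    using x f_x \<delta> by (simp add: slice_def unit_ball_def)
  \<comment> \<open>Some term of a sum \<open>g A y > 1/2\<close> reaches
    \<open>1 / (2 * real (card A))\<close>; \<open>\<bar>x i\<bar>\<close> is positive because
    \<open>A\<close> lies in the support.\<close>
  define U where "U = (\<lambda>(A, i). min \<bar>x i\<bar> (1 / (2 * real (card A)))) ` Sigma M (\<lambda>A. A)"
  have finU: "finite U" unfolding U_def using finM MA(2) by blast
  have "min \<bar>x i\<bar> (1 / (2 * real (card A))) > 0" if "A \<in> M" "i \<in> A" for A i
    using that MA(2,3)[OF that(1)] by (auto simp: card_gt_0_iff)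
  then have Upos: "u > 0" if "u \<in> U" for u
    using that by (auto simp: U_def)
  \<comment> \<open>The entry \<open>\<gamma>/2\<close> serves the sets \<open>B\<close> whose
    \<open>x\<close>-sum is at most \<open>1 - \<gamma>\<close>.\<close>
  define \<kappa> where "\<kappa> = Min (insert (\<gamma>/2) U)"
  have \<kappa>: "\<kappa> > 0" using \<gamma> finU Upos by (auto simp: \<kappa>_def)
  have \<kappa>\<gamma>: "2 * \<kappa> \<le> \<gamma>" using finU Min_le[of "insert (\<gamma>/2) U" "\<gamma>/2"] by (simp add: \<kappa>_def)
  have \<kappa>U: "\<kappa> \<le> \<bar>x i\<bar>" "\<kappa> \<le> 1 / (2 * real (card A))" if "A \<in> M" "i \<in> A" for A i
  proof -
    have "min \<bar>x i\<bar> (1 / (2 * real (card A))) \<in> U"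
      unfolding U_def using that by force
    then have "\<kappa> \<le> min \<bar>x i\<bar> (1 / (2 * real (card A)))"
      unfolding \<kappa>_def using finU by (intro Min_le) blast+
    then show "\<kappa> \<le> \<bar>x i\<bar>" "\<kappa> \<le> 1 / (2 * real (card A))" by simp_all
  qed
  \<comment> \<open>The tolerance \<open>\<kappa>\<close> is half the loss
    \<open>2 * \<kappa>\<close> that cancellation will give, hence the contradiction.\<close>
  obtain y where y: "y \<in> slice ?V ?N f \<delta>" "?N (x - y) \<ge> 2 - \<kappa>"
    using dp fS \<delta> xS \<kappa> unfolding delta_point_def by blast
  have yV: "y \<in> ?V" "?N y \<le> 1" "1 - \<delta> < f y"
    using y(1) by (auto simp: slice_def unit_ball_def)
  have g_y: "1/2 < g A y" if "A \<in> M" for A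
    using finite_average_near_max[OF finM _ that, of "\<lambda>A. g A y" \<delta>] g_le[OF _ yV(1)] yV(2,3) cM
    by (force simp: f_def \<delta>_def)
  have bound: "(\<Sum>i\<in>B. \<bar>(x - y) i\<bar>) \<le> 2 - 2 * \<kappa>" if B: "B \<in> \<A>" "finite B" for B
  proof -
    have Bx: "(\<Sum>i\<in>B. \<bar>x i\<bar>) \<le> 1" and By: "(\<Sum>i\<in>B. \<bar>y i\<bar>) \<le> 1"
      using h1_norm_sum_le[OF assms(1) _ B] x yV by force+
    show ?thesis
    proof (cases "1 - \<gamma> < (\<Sum>i\<in>B. \<bar>x i\<bar>)")
      case False
      have "(\<Sum>i\<in>B. \<bar>(x - y) i\<bar>) \<le> (\<Sum>i\<in>B. \<bar>x i\<bar> + \<bar>y i\<bar>)"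
        by (rule sum_mono) simp
      with False By \<kappa>\<gamma> show ?thesis by (simp add: sum.distrib)
    next
      case True
      then obtain A where A: "A \<in> M" "A \<subseteq> B" using gap B by blast
      have "\<exists>i\<in>A. 1 / (2 * real (card A)) \<le> sgn (x i) * y i"
      proof (rule ccontr)
        assume "\<not> ?thesis"
        then have "g A y \<le> card A * (1 / (2 * real (card A)))"
          unfolding g_def by (intro sum_bounded_above) force
        also have "\<dots> \<le> 1/2" by simp
        finally show False using g_y[OF A(1)] by simp
      qed
      then obtain i where i: "i \<in> A" "1 / (2 * real (card A)) \<le> sgn (x i) * y i" by blast
      have "\<bar>x i - y i\<bar> \<le> \<bar>x i\<bar> + \<bar>y i\<bar> - 2 * \<kappa>"
        using i(2) \<kappa> \<kappa>U[OF A(1) i(1)] by (intro abs_diff_cancellation) auto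
      moreover have "i \<in> B" using A(2) i(1) by blast
      moreover have "(\<Sum>j\<in>B - {i}. \<bar>x j - y j\<bar>) \<le> (\<Sum>j\<in>B - {i}. \<bar>x j\<bar> + \<bar>y j\<bar>)"
        by (rule sum_mono) simp
      ultimately show ?thesis
        using Bx By B(2) by (simp add: sum.remove[of B i] sum.distrib)
    qed
  qed
  have "x - y \<in> ?V" by (rule subspace_diff[OF subspace_h1_space[OF assms(1)] x(1) yV(1)])
  moreover have "0 \<le> 2 - 2 * \<kappa>"
    using bound[of "{}"] adequate_empty[OF assms(1)] by simp
  ultimately have "?N (x - y) \<le> 2 - 2 * \<kappa>"
    using h1_norm_le_iff[OF assms(1)] bound by blast
  with y(2) \<kappa> show False by simp
qed

end
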